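(* Let $\mathcal{T}=(t_{ijkl})\in\widehat{\mathcal{E}}_{4,3}$ and suppose $t_{iiij}t_{ijjj}=1$ for all $i,j\in\{1,2,3\}$ with $i\neq j$. Then $\mathcal{T}$ is positive semi-definite if and only if $$t_{iiij}\,t_{jjjk}\,t_{ikkk}=t_{iijk}\,t_{iiij}\,t_{iiik}=t_{iijj}=1$$ for all pairwise distinct $i,j,k\in\{1,2,3\}$.
   Context: A 4th order 3-dimensional real tensor $\mathcal{T}=(t_{ijkl})_{i,j,k,l\in\{1,2,3\}}$ is symmetric if its entries are invariant under all permutations of the four indices (so, e.g., $t_{ijjk}$ denotes the common value of all entries whose index multiset is $\{i,j,j,k\}$). $\widehat{\mathcal{E}}_{4,3}$ is the set of symmetric 4th order 3-dimensional tensors all of whose entries lie in $\{-1,0,1\}$ and whose diagonal entries satisfy $t_{1111}=t_{2222}=t_{3333}=1$. For $x\in\mathbb{R}^3$ put $\mathcal{T}x^4=\sum_{i,j,k,l=1}^3 t_{ijkl}x_ix_jx_kx_l$. $\mathcal{T}$ is positive semi-definite if $\mathcal{T}x^4\ge 0$ for all $x\in\mathbb{R}^3$. *)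

theory Defs
  imports "HOL-Analysis.Analysis" "HOL-Combinatorics.Permutations"
begin

text \<open>Indices range over the three-element numeral type \<open>3\<close> (in which \<open>3 = 0\<close>), so that
  \<open>real ^ 3\<close> is the matching vector space.\<close>

type_synonym tensor43 = "3 \<Rightarrow> 3 \<Rightarrow> 3 \<Rightarrow> 3 \<Rightarrow> real"

text \<open>Here \<open>c\<close> assigns an index to each of the positions 0, 1, 2, 3, and \<open>p\<close> permutes the positions.\<close>

definition symmetric_tensor43 :: "tensor43 \<Rightarrow> bool" where
  "symmetric_tensor43 T \<longleftrightarrow>
     (\<forall>p c. p permutes {..<4::nat} \<longrightarrow>
        T (c (p 0)) (c (p 1)) (c (p 2)) (c (p 3)) = T (c 0) (c 1) (c 2) (c 3))"

definition E_hat_43 :: "tensor43 set" where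
  "E_hat_43 = {T. symmetric_tensor43 T \<and>
                  (\<forall>i j k l. T i j k l \<in> {-1, 0, 1}) \<and>
                  T 1 1 1 1 = 1 \<and> T 2 2 2 2 = 1 \<and> T 3 3 3 3 = 1}"

definition tensor43_form :: "tensor43 \<Rightarrow> real ^ 3 \<Rightarrow> real" where
  "tensor43_form T x = (\<Sum>i\<in>UNIV. \<Sum>j\<in>UNIV. \<Sum>k\<in>UNIV. \<Sum>l\<in>UNIV.
     T i j k l * x $ i * x $ j * x $ k * x $ l)"

definition psd_tensor43 :: "tensor43 \<Rightarrow> bool" where
  "psd_tensor43 T \<longleftrightarrow> (\<forall>x. tensor43_form T x \<ge> 0)"

end

theory Submission
  imports Defs
begin

text \<open>
  Write \<open>a, b, c\<close> for the signs \<open>t\<^sub>i\<^sub>i\<^sub>i\<^sub>j, t\<^sub>i\<^sub>i\<^sub>i\<^sub>k, t\<^sub>j\<^sub>j\<^sub>j\<^sub>k\<close>. Under the stated conditions the form is the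
  fourth power of the linear form \<open>x\<^sub>i + a x\<^sub>j + b x\<^sub>k\<close>. Conversely, evaluating at \<open>(1, -a, 0)\<close>
  forces \<open>t\<^sub>i\<^sub>i\<^sub>j\<^sub>j = 1\<close>, which makes \<open>(1, -a, 0)\<close> a zero of the form. If \<open>a b c = -1\<close>, the derivative
  in the third direction at this zero is a nonzero number, so the form changes sign nearby. If
  \<open>a b c = 1\<close>, a sign change of the variables reduces to \<open>a = b = c = 1\<close>, where the form is
  \<open>(x + y + z)\<^sup>4 + 12 x y z (e\<^sub>1 x + e\<^sub>2 y + e\<^sub>3 z)\<close> with \<open>e\<^sub>i \<le> 0\<close>; the permutations of \<open>(1, 1, -2)\<close>
  show that the \<open>e\<^sub>i\<close> coincide, and \<open>(1, 1, -3)\<close> shows that they vanish.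
\<close>

text \<open>The factors 4, 6, 12 count index arrangements. One letter serves both cubic terms of a
  pair of variables, since \<open>T i i i j\<close> and \<open>T i j j j\<close> agree under the
  hypothesis on their product.\<close>

definition ternary_quartic ::
  "real \<Rightarrow> real \<Rightarrow> real \<Rightarrow> real \<Rightarrow> real \<Rightarrow> real \<Rightarrow> real \<Rightarrow> real \<Rightarrow> real \<Rightarrow> real \<Rightarrow> real \<Rightarrow> real \<Rightarrow> real"
  where "ternary_quartic a b c r s t d e f x y z =
    x^4 + y^4 + z^4
    + 4 * a * (x^3 * y + x * y^3) + 4 * b * (x^3 * z + x * z^3) + 4 * c * (y^3 * z + y * z^3)
    + 6 * (r * x^2 * y^2 + s * x^2 * z^2 + t * y^2 * z^2)
    + 12 * (d * x^2 * y * z + e * x * y^2 * z + f * x * y * z^2)"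

text \<open>Permuting the indices of the tensor turns the facts about \<open>r\<close> and
  \<open>d\<close> into those about the other square and mixed coefficients, so the conclusion
  covers only these two.\<close>

lemma ternary_quartic_nonneg_imp:
  assumes nonneg: "\<And>x y z. ternary_quartic a b c r s t d e f x y z \<ge> 0"
    and abc: "a \<in> {-1, 1}" "b \<in> {-1, 1}" "c \<in> {-1, 1}"
    and rst: "r \<le> 1" "s \<le> 1" "t \<le> 1"
    and "def": "d \<in> {-1, 0, 1}" "e \<in> {-1, 0, 1}" "f \<in> {-1, 0, 1}"
  shows "a * b * c = 1 \<and> r = 1 \<and> d = a * b"
proof -
  note unfolded = ternary_quartic_def power2_eq_square power3_eq_cube power4_eq_xxxx
  have r: "r = 1"
    using nonneg[of 1 "-a" 0] abc rst by (auto simp: unfolded)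
  have s: "s = 1"
    using nonneg[of 1 0 "-b"] abc rst by (auto simp: unfolded)
  have t: "t = 1"
    using nonneg[of 0 1 "-c"] abc rst by (auto simp: unfolded)
  have c: "c = a * b"
  proof (rule ccontr)
    assume "c \<noteq> a * b"
    then have "c = - (a * b)"
      using abc by auto
    then show False
      \<comment> \<open>At \<open>(1, -a, z)\<close> the coefficient of \<open>z\<close> is
        \<open>8*b + 12*(e - a*d)\<close>, of absolute value at least 4 because
        \<open>e - a*d\<close> is an integer. For \<open>\<bar>z\<bar> = 1/10\<close> the linear
        term outweighs the others, which add up to at most
        \<open>24*z^2 + 8*\<bar>z\<bar>^3 + z^4\<close>.\<close>
      using nonneg[of 1 "-a" "b/10"] nonneg[of 1 "-a" "-b/10"] abc(1,2) "def"
      unfolding r s t by (elim insertE emptyE) (simp_all add: unfolded)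
  qed
  \<comment> \<open>After the sign change the excesses are \<open>a*b*d - 1\<close>,
    \<open>b*e - 1\<close> and \<open>a*f - 1\<close>. At the points with coordinate sum zero, each
    is at least the mean of the other two, so all equal some integer m \<le> 0; the last point gives
    1 + 36 m \<ge> 0.\<close>
  have "d = a * b"
    using nonneg[of 1 a "-2*b"] nonneg[of 1 "-2*a" b] nonneg[of "-2" a b] nonneg[of 1 a "-3*b"]
      abc(1,2) "def"
    unfolding r s t c by (elim insertE emptyE) (simp_all add: unfolded)
  with r c abc show ?thesis
    by auto
qed

text \<open>Expansion yields coefficients such as \<open>12*a^2*b\<close> for
  \<open>x*y^2*z\<close>; reducing even powers of the signs to 1 leaves those listed.\<close>

lemma ternary_quartic_eq_fourth_power:
  assumes "a\<^sup>2 = 1" "b\<^sup>2 = 1"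
  shows "ternary_quartic a b (a * b) 1 1 1 (a * b) b a x y z = (x + a * y + b * z)^4"
proof -
  have "a * a = 1" "b * b = 1"
    using assms by (simp_all add: power2_eq_square)
  then show ?thesis
    unfolding ternary_quartic_def by algebra
qed

text \<open>Adjacent transpositions generate all permutations of the positions, so these equations
  suffice for every reordering of indices below.\<close>

lemma symmetric_tensor43_swap:
  assumes "symmetric_tensor43 T"
  shows "T i j k l = T j i k l" "T i j k l = T i k j l" "T i j k l = T i j l k"
proof -
  define c where "c = (\<lambda>n::nat. if n = 0 then i else if n = 1 then j else if n = 2 then k else l)"
  have sym: "T (c (p 0)) (c (p 1)) (c (p 2)) (c (p 3)) = T (c 0) (c 1) (c 2) (c 3)"
    if "p permutes {..<4}" for p
    using assms that unfolding symmetric_tensor43_def by blast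
  show "T i j k l = T j i k l"
    using sym[OF permutes_swap_id[of 0 _ 1]] by (simp add: c_def transpose_def)
  show "T i j k l = T i k j l"
    using sym[OF permutes_swap_id[of 1 _ 2]] by (simp add: c_def transpose_def)
  show "T i j k l = T i j l k"
    using sym[OF permutes_swap_id[of 2 _ 3]] by (simp add: c_def transpose_def)
qed

lemma UNIV_3_eq_distinct:
  fixes i j k :: 3
  assumes "i \<noteq> j" "i \<noteq> k" "j \<noteq> k"
  shows "UNIV = {i, j, k}"
  by (rule sym, rule card_subset_eq) (use assms in auto)

lemma tensor43_form_eq_ternary_quartic:
  assumes sym: "symmetric_tensor43 T"
    and distinct: "i \<noteq> j" "i \<noteq> k" "j \<noteq> k"
    and diag: "T i i i i = 1" "T j j j j = 1" "T k k k k = 1"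
    and cubic: "T i j j j = T i i i j" "T i k k k = T i i i k" "T j k k k = T j j j k"
  shows "tensor43_form T x =
    ternary_quartic (T i i i j) (T i i i k) (T j j j k) (T i i j j) (T i i k k) (T j j k k)
      (T i i j k) (T i j j k) (T i j k k) (x $ i) (x $ j) (x $ k)"
proof -
  note swap = symmetric_tensor43_swap[OF sym]
  \<comment> \<open>Normal forms list i before j before k; entries of type \<open>i j j j\<close>
    are also turned into \<open>i i i j\<close> by \<open>cubic\<close>.\<close>
  have sorted:
    "T i i j i = T i i i j" "T i j i i = T i i i j" "T j i i i = T i i i j"
    "T i i k i = T i i i k" "T i k i i = T i i i k" "T k i i i = T i i i k"
    "T j j k j = T j j j k" "T j k j j = T j j j k" "T k j j j = T j j j k"
    "T j i j j = T i i i j" "T j j i j = T i i i j" "T j j j i = T i i i j"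
    "T k i k k = T i i i k" "T k k i k = T i i i k" "T k k k i = T i i i k"
    "T k j k k = T j j j k" "T k k j k = T j j j k" "T k k k j = T j j j k"
    "T i j i j = T i i j j" "T i j j i = T i i j j" "T j i i j = T i i j j"
    "T j i j i = T i i j j" "T j j i i = T i i j j"
    "T i k i k = T i i k k" "T i k k i = T i i k k" "T k i i k = T i i k k"
    "T k i k i = T i i k k" "T k k i i = T i i k k"
    "T j k j k = T j j k k" "T j k k j = T j j k k" "T k j j k = T j j k k"
    "T k j k j = T j j k k" "T k k j j = T j j k k"
    "T i i k j = T i i j k" "T i j i k = T i i j k" "T i k i j = T i i j k"
    "T i j k i = T i i j k" "T i k j i = T i i j k" "T j i i k = T i i j k"
    "T k i i j = T i i j k" "T j i k i = T i i j k" "T k i j i = T i i j k"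
    "T j k i i = T i i j k" "T k j i i = T i i j k"
    "T j j i k = T i j j k" "T j j k i = T i j j k" "T j i j k = T i j j k"
    "T j k j i = T i j j k" "T j i k j = T i j j k" "T j k i j = T i j j k"
    "T i j k j = T i j j k" "T k j j i = T i j j k" "T k j i j = T i j j k"
    "T i k j j = T i j j k" "T k i j j = T i j j k"
    "T k k i j = T i j k k" "T k k j i = T i j k k" "T k i k j = T i j k k"
    "T k j k i = T i j k k" "T k i j k = T i j k k" "T k j i k = T i j k k"
    "T i k k j = T i j k k" "T j k k i = T i j k k" "T i k j k = T i j k k"
    "T j k i k = T i j k k" "T j i k k = T i j k k"
    using cubic by (metis swap)+
  have sum_UNIV: "(\<Sum>l\<in>UNIV. g l) = g i + g j + g k" for g :: "3 \<Rightarrow> real"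
    using distinct by (simp add: UNIV_3_eq_distinct[OF distinct] add.assoc)
  show ?thesis
    unfolding tensor43_form_def sum_UNIV sorted cubic diag ternary_quartic_def
    by (simp add: algebra_simps power2_eq_square power3_eq_cube power4_eq_xxxx)
qed

theorem theorem3p2:
  fixes T :: tensor43
  assumes "T \<in> E_hat_43"
    and "\<And>i j. i \<noteq> j \<Longrightarrow> T i i i j * T i j j j = 1"
  shows "psd_tensor43 T \<longleftrightarrow>
    (\<forall>i j k. i \<noteq> j \<and> i \<noteq> k \<and> j \<noteq> k \<longrightarrow>
       T i i i j * T j j j k * T i k k k = 1 \<and>
       T i i j k * T i i i j * T i i i k = 1 \<and>
       T i i j j = 1)"
proof -
  have sym: "symmetric_tensor43 T"
    and entries: "T i j k l \<in> {-1, 0, 1}" for i j k l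
    using assms(1) by (auto simp: E_hat_43_def)
  note swap = symmetric_tensor43_swap[OF sym]
  have diag: "T i i i i = 1" for i
    using assms(1) exhaust_3[of i] by (auto simp: E_hat_43_def)
  have sign: "T i i i j \<in> {-1, 1}" and cubic: "T i j j j = T i i i j" if "i \<noteq> j" for i j
    using assms(2)[OF that] entries[of i i i j] entries[of i j j j] by auto
  have form: "tensor43_form T x =
      ternary_quartic (T i i i j) (T i i i k) (T j j j k) (T i i j j) (T i i k k) (T j j k k)
        (T i i j k) (T i j j k) (T i j k k) (x $ i) (x $ j) (x $ k)"
    if "i \<noteq> j" "i \<noteq> k" "j \<noteq> k" for i j k x
    using that by (intro tensor43_form_eq_ternary_quartic sym diag cubic)
  show ?thesis
  proof (intro iffI allI impI)
    fix i j k :: 3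
    assume psd: "psd_tensor43 T" and "i \<noteq> j \<and> i \<noteq> k \<and> j \<noteq> k"
    then have distinct: "i \<noteq> j" "i \<noteq> k" "j \<noteq> k"
      by auto
    have nonneg: "ternary_quartic (T i i i j) (T i i i k) (T j j j k) (T i i j j) (T i i k k) (T j j k k)
        (T i i j k) (T i j j k) (T i j k k) u v w \<ge> 0" for u v w
    proof -
      have "tensor43_form T (\<chi> l. if l = i then u else if l = j then v else w) \<ge> 0"
        using psd unfolding psd_tensor43_def by blast
      then show ?thesis
        using distinct by (simp add: form[OF distinct])
    qed
    have le_1: "T i j k l \<le> 1" for i j k l
      using entries[of i j k l] by auto
    have "T i i i j * T i i i k * T j j j k = 1 \<and> T i i j j = 1
        \<and> T i i j k = T i i i j * T i i i k"
      by (rule ternary_quartic_nonneg_imp[OF nonneg]) (intro entries le_1 sign distinct)+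
    then show "T i i i j * T j j j k * T i k k k = 1 \<and>
        T i i j k * T i i i j * T i i i k = 1 \<and> T i i j j = 1"
      using sign[OF distinct(1)] sign[OF distinct(2)] cubic[OF distinct(2)] by auto
  next
    assume R: "\<forall>i j k. i \<noteq> j \<and> i \<noteq> k \<and> j \<noteq> k \<longrightarrow>
       T i i i j * T j j j k * T i k k k = 1 \<and>
       T i i j k * T i i i j * T i i i k = 1 \<and>
       T i i j j = 1"
    have distinct: "(1::3) \<noteq> 2" "(1::3) \<noteq> 3" "(2::3) \<noteq> 3"
      by simp_all
    define a b c where "a = T 1 1 1 2" and "b = T 1 1 1 3" and "c = T 2 2 2 3"
    have signs: "a \<in> {-1, 1}" "b \<in> {-1, 1}" "c \<in> {-1, 1}"
      unfolding a_def b_def c_def by (intro sign distinct)+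
    have "T 1 3 3 3 = b" "T 2 2 2 1 = a" "T 3 3 3 1 = b" "T 3 3 3 2 = c"
      unfolding a_def b_def c_def using cubic distinct by (metis swap)+
    moreover have "T 1 2 2 3 = T 2 2 1 3" "T 1 2 3 3 = T 3 3 1 2"
      by (metis swap)+
    \<comment> \<open>The first three orderings determine \<open>c\<close> and the mixed entries;
      the last two add \<open>T 1 1 3 3\<close> and \<open>T 2 2 3 3\<close>.\<close>
    ultimately have "c = a * b" "T 1 1 2 3 = a * b" "T 1 2 2 3 = b" "T 1 2 3 3 = a"
      and "T 1 1 2 2 = 1" "T 1 1 3 3 = 1" "T 2 2 3 3 = 1"
      using R[rule_format, of 1 2 3] R[rule_format, of 2 1 3] R[rule_format, of 3 1 2]
        R[rule_format, of 1 3 2] R[rule_format, of 2 3 1] signs distinct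
      by (auto simp flip: a_def b_def c_def)
    then have "tensor43_form T x = (x $ 1 + a * x $ 2 + b * x $ 3)^4" for x
      unfolding form[OF distinct]
      using ternary_quartic_eq_fourth_power[of a b] signs
      by (auto simp flip: a_def b_def c_def)
    then show "psd_tensor43 T"
      unfolding psd_tensor43_def by simp
  qed
qed

end
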